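(* Let $k,n$ be positive integers and $\chi$ a simple character of a subgroup $G\subseteq S_k$. Then, in coordinates $(x_z)_{z\in[n]^k}$ of $\mathbb{P}((\mathbb{C}^n)^{\otimes k})$ with respect to the basis $\{e_z\}$, the set $\mathrm{Im}(\widehat{P}^{(n)}_\chi)$ is described by the parametric equations $$x_z=\chi_{z,(1,\dots,k)}(A),\qquad z\in[n]^k,$$ where $A=(a_{ij})\in\mathrm{Mat}_{n,k}(\mathbb{C})$ is a matrix of parameters none of whose columns is the zero vector; that is, $\mathrm{Im}(\widehat{P}^{(n)}_\chi)$ is the set of points $\big[\sum_{z\in[n]^k}\chi_{z,(1,\dots,k)}(A)e_z\big]$ for such matrices $A$ for which this vector is nonzero.
   Context: $V=\mathbb{C}^n$ with basis $e_1,\dots,e_n$; $e_x=e_{x_1}\otimes\cdots\otimes e_{x_k}$ for $x\in[n]^k$. $S_k$ acts on $[n]^k$ by $w(x)=(x_{w^{-1}(1)},\dots,x_{w^{-1}(k)})$ and on $V^{\otimes k}$ by $w(e_x)=e_{w(x)}$; this gives an algebra morphism $\mathbb{C}[S_k]\to\mathrm{End}(V^{\otimes k})$, $P\mapsto P^{(n)}$. $P_\chi=\frac{\chi(e)}{|G|}\sum_{g\in G}\chi(g^{-1})g$. With $\mathrm{Seg}(k,n)=\{[v_1\otimes\cdots\otimes v_k]:v_i\in V\setminus\{0\}\}$, the map $\widehat{P}^{(n)}_\chi:\mathrm{Seg}(k,n)\setminus\mathbb{P}(\ker P^{(n)}_\chi)\to\mathbb{P}(V^{\otimes k})$ sends $[v_1\otimes\cdots\otimes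 v_k]$ to $[P^{(n)}_\chi(v_1\otimes\cdots\otimes v_k)]$. For $M\in\mathrm{Mat}_{m,n'}(\mathbb{C})$, $(M^{\otimes k})_{x,y}=\prod_{i=1}^k M_{x_i,y_i}$ ($x\in[m]^k,y\in[n']^k$), and $\chi_{x,y}(M)=\sum_{g\in G}\chi(g)(M^{\otimes k})_{g(x),y}$. *)

theory Defs
  imports
    "HOL-Analysis.Analysis"
    "HOL-Algebra.Bij"
    "Jordan_Normal_Form.VS_Connect"
begin

no_notation vec_index (infixl \<open>$\<close> 100)

text \<open>Dimensions of vectors, tensors and parameter matrices are finite index types: \<open>'n\<close> stands
  for \<open>[n]\<close> and \<open>'k\<close> for \<open>[k]\<close>, so that multi-indices in \<open>[n]^k\<close> are functions \<open>'k \<Rightarrow> 'n\<close>, and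
  \<open>(1,\<dots>,k) \<in> [k]^k\<close> is the identity function. The tensor power \<open>(\<complex>^n)^{\<otimes>k}\<close> is
  \<open>complex ^ ('k \<Rightarrow> 'n)\<close>.\<close>

subsection \<open>Simple characters\<close>

definition mat_trace :: "complex Matrix.mat \<Rightarrow> complex"
  where "mat_trace A = (\<Sum>i<dim_row A. A $$ (i, i))"

text \<open>A representation of degree \<open>d\<close> is a homomorphism into \<open>GL_d(\<complex>)\<close>, the group of units of the
  ring of \<open>d \<times> d\<close> matrices.\<close>

definition representation :: "('g, 'b) monoid_scheme \<Rightarrow> nat \<Rightarrow> ('g \<Rightarrow> complex Matrix.mat) \<Rightarrow> bool"
  where "representation H d \<rho> \<longleftrightarrow> \<rho> \<in> hom H (units_of (ring_mat TYPE(complex) d ()))"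

definition simple_representation ::
    "('g, 'b) monoid_scheme \<Rightarrow> nat \<Rightarrow> ('g \<Rightarrow> complex Matrix.mat) \<Rightarrow> bool"
  where "simple_representation H d \<rho> \<longleftrightarrow>
    representation H d \<rho> \<and> d > 0 \<and>
    (\<forall>W. VectorSpace.subspace class_ring W (module_vec TYPE(complex) d) \<and>
         (\<forall>g\<in>carrier H. \<forall>w\<in>W. \<rho> g *\<^sub>v w \<in> W) \<longrightarrow>
         W = {0\<^sub>v d} \<or> W = carrier_vec d)"

text \<open>Values of a character outside the carrier of the group are irrelevant.\<close>

definition simple_character :: "('g, 'b) monoid_scheme \<Rightarrow> ('g \<Rightarrow> complex) \<Rightarrow> bool"
  where "simple_character H chi \<longleftrightarrow>
    (\<exists>d \<rho>. simple_representation H d \<rho> \<and> (\<forall>g\<in>carrier H. chi g = mat_trace (\<rho> g)))"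

subsection \<open>Tensors and the action of the symmetric group\<close>

abbreviation Sym :: "('k \<Rightarrow> 'k) monoid"
  where "Sym \<equiv> BijGroup UNIV"

definition pure_tensor :: "('k::finite \<Rightarrow> complex ^ 'n::finite) \<Rightarrow> complex ^ ('k \<Rightarrow> 'n)"
  where "pure_tensor v = (\<chi> x. \<Prod>i\<in>UNIV. v i $ x i)"

definition basis_tensor :: "('k::finite \<Rightarrow> 'n::finite) \<Rightarrow> complex ^ ('k \<Rightarrow> 'n)"
  where "basis_tensor x = pure_tensor (\<lambda>i. axis (x i) 1)"

definition perm_index :: "('k \<Rightarrow> 'k) \<Rightarrow> ('k \<Rightarrow> 'n) \<Rightarrow> ('k \<Rightarrow> 'n)"
  where "perm_index w x = (\<lambda>i. x (inv_into UNIV w i))"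

text \<open>The linear extension of \<open>e_x \<mapsto> e_{w(x)}\<close>.\<close>

definition perm_tensor ::
    "('k::finite \<Rightarrow> 'k) \<Rightarrow> complex ^ ('k \<Rightarrow> 'n::finite) \<Rightarrow> complex ^ ('k \<Rightarrow> 'n)"
  where "perm_tensor w t = (\<Sum>x\<in>UNIV. t $ x *s basis_tensor (perm_index w x))"

text \<open>An element of the group algebra \<open>\<complex>[S_k]\<close> is given by its coefficient function; the following is
  the map \<open>P \<mapsto> P^{(n)}\<close>.\<close>

definition algebra_op ::
    "(('k::finite \<Rightarrow> 'k) \<Rightarrow> complex) \<Rightarrow> complex ^ ('k \<Rightarrow> 'n::finite) \<Rightarrow> complex ^ ('k \<Rightarrow> 'n)"
  where "algebra_op P t = (\<Sum>w\<in>carrier Sym. P w *s perm_tensor w t)"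

definition P_char :: "('k \<Rightarrow> 'k) set \<Rightarrow> (('k \<Rightarrow> 'k) \<Rightarrow> complex) \<Rightarrow> ('k \<Rightarrow> 'k) \<Rightarrow> complex"
  where "P_char G chi =
    (\<lambda>g. if g \<in> G then chi id / of_nat (card G) * chi (inv_into UNIV g) else 0)"

subsection \<open>Projective spaces\<close>

text \<open>The point \<open>[v]\<close> for \<open>v \<noteq> 0\<close> is the line spanned by \<open>v\<close>.\<close>

definition proj_point :: "complex ^ 'a::finite \<Rightarrow> (complex ^ 'a) set"
  where "proj_point v = vec.span {v}"

definition proj_space :: "(complex ^ 'a::finite) set \<Rightarrow> (complex ^ 'a) set set"
  where "proj_space W = proj_point ` (W - {0})"

definition Seg :: "(complex ^ ('k::finite \<Rightarrow> 'n::finite)) set set"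
  where "Seg = {proj_point (pure_tensor v) | v. \<forall>i. v i \<noteq> 0}"

text \<open>The projective map induced by a linear map \<open>f\<close>, \<open>[v] \<mapsto> [f v]\<close> for \<open>f v \<noteq> 0\<close>.\<close>

definition proj_map ::
    "(complex ^ 'a::finite \<Rightarrow> complex ^ 'b::finite) \<Rightarrow> (complex ^ 'a) set \<Rightarrow> (complex ^ 'b) set"
  where "proj_map f L = f ` L"

lemma proj_map_point:
  assumes "Vector_Spaces.linear (*s) (*s) f"
  shows "proj_map f (proj_point v) = proj_point (f v)"
proof -
  interpret f: Vector_Spaces.linear "(*s)" "(*s)" f by fact
  show ?thesis
    by (simp add: proj_map_def proj_point_def vec.span_singleton image_image f.scale)
qed

definition P_hat_domain ::
    "('k::finite \<Rightarrow> 'k) set \<Rightarrow> (('k \<Rightarrow> 'k) \<Rightarrow> complex) \<Rightarrow> (complex ^ ('k \<Rightarrow> 'n::finite)) set set"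
  where "P_hat_domain G chi = Seg - proj_space {t. algebra_op (P_char G chi) t = 0}"

definition P_hat ::
    "('k::finite \<Rightarrow> 'k) set \<Rightarrow> (('k \<Rightarrow> 'k) \<Rightarrow> complex) \<Rightarrow>
     (complex ^ ('k \<Rightarrow> 'n::finite)) set \<Rightarrow> (complex ^ ('k \<Rightarrow> 'n)) set"
  where "P_hat G chi = proj_map (algebra_op (P_char G chi))"

lemma linear_algebra_op: "Vector_Spaces.linear (*s) (*s) (algebra_op P)"
proof (unfold_locales, goal_cases)
  case (1 s t)
  show ?case
    by (simp add: algebra_op_def perm_tensor_def vec.scale_right_distrib
        vec.scale_left_distrib sum.distrib)
next
  case (2 c t)
  show ?case
    by (simp add: algebra_op_def perm_tensor_def vec.scale_sum_right mult_ac)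
qed

lemma P_hat_pure_tensor:
  "P_hat G chi (proj_point (pure_tensor v)) =
    proj_point (algebra_op (P_char G chi) (pure_tensor v))"
  by (simp add: P_hat_def proj_map_point linear_algebra_op)

lemma basis_tensor_eq_axis: "basis_tensor x = axis x 1"
proof -
  have "(\<Prod>i\<in>UNIV. axis (x i) (1::complex) $ y i) = (if y = x then 1 else 0)" for y
  proof (cases "y = x")
    case False
    then obtain i where "y i \<noteq> x i" by auto
    then show ?thesis using False by (auto simp: axis_def intro!: exI[of _ i])
  qed (simp add: axis_def)
  then show ?thesis
    by (simp add: basis_tensor_def pure_tensor_def vec_eq_iff) (simp add: axis_def)
qed

lemma perm_tensor_basis: "perm_tensor w (basis_tensor x) = basis_tensor (perm_index w x)"
proof -
  have "perm_tensor w (basis_tensor x)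
      = (\<Sum>y\<in>UNIV. if y = x then basis_tensor (perm_index w y) else 0)"
    unfolding perm_tensor_def by (intro sum.cong) (auto simp: basis_tensor_eq_axis axis_def)
  then show ?thesis by simp
qed

subsection \<open>The functions \<open>\<chi>_{x,y}\<close>\<close>

definition tensor_power_entry ::
    "complex ^ 'q::finite ^ 'm::finite \<Rightarrow> ('k::finite \<Rightarrow> 'm) \<Rightarrow> ('k \<Rightarrow> 'q) \<Rightarrow> complex"
  where "tensor_power_entry M x y = (\<Prod>i\<in>UNIV. M $ x i $ y i)"

definition chi_entry ::
    "('k::finite \<Rightarrow> 'k) set \<Rightarrow> (('k \<Rightarrow> 'k) \<Rightarrow> complex) \<Rightarrow> ('k \<Rightarrow> 'm::finite) \<Rightarrow> ('k \<Rightarrow> 'q::finite) \<Rightarrow>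
     complex ^ 'q ^ 'm \<Rightarrow> complex"
  where "chi_entry G chi x y M = (\<Sum>g\<in>G. chi g * tensor_power_entry M (perm_index g x) y)"

end

theory Submission
  imports Defs
begin

text \<open>The coordinate of \<open>P\<^sub>\<chi> (v\<^sub>1 \<otimes> \<dots> \<otimes> v\<^sub>k)\<close> at \<open>z\<close> is \<open>\<chi>(e) / |G|\<close> times the value of
  \<open>\<chi>\<^sub>z\<^sub>,\<^sub>i\<^sub>d\<close> at the matrix with columns \<open>v\<^sub>1, \<dots>, v\<^sub>k\<close>; since \<open>\<chi>(e)\<close> is the degree of the
  representation, this factor is nonzero and disappears projectively.\<close>

lemma simple_character_one_nonzero:
  assumes "group H" and "simple_character H chi"
  shows "chi \<one>\<^bsub>H\<^esub> \<noteq> 0"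
proof -
  from assms(2) obtain d \<rho> where d: "d > 0"
    and \<rho>: "\<rho> \<in> hom H (units_of (ring_mat TYPE(complex) d ()))"
    and chi: "\<And>g. g \<in> carrier H \<Longrightarrow> chi g = mat_trace (\<rho> g)"
    by (auto simp: simple_character_def simple_representation_def representation_def)
  interpret R: ring "ring_mat TYPE(complex) d ()" by (rule ring_mat)
  \<comment> \<open>The target has to be a group here: a multiplicative map into all matrices could
    send the identity to any idempotent.\<close>
  have "\<rho> \<one>\<^bsub>H\<^esub> = \<one>\<^bsub>units_of (ring_mat TYPE(complex) d ())\<^esub>"
    using hom_one[OF \<rho> assms(1) R.units_group] .
  then have "\<rho> \<one>\<^bsub>H\<^esub> = 1\<^sub>m d"
    by (simp add: units_of_def ring_mat_def)
  then have "chi \<one>\<^bsub>H\<^esub> = of_nat d"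
    using chi[of "\<one>\<^bsub>H\<^esub>"] group.is_monoid[OF assms(1)]
    by (simp add: mat_trace_def monoid.one_closed)
  with d show ?thesis by simp
qed

text \<open>A nonzero coordinate picked in each factor gives a multi-index at which the entry is a
  product of nonzero numbers.\<close>

lemma pure_tensor_nonzero:
  assumes "\<And>i. v i \<noteq> 0"
  shows "pure_tensor v \<noteq> 0"
proof -
  have "\<forall>i. \<exists>j. v i $ j \<noteq> 0" using assms by (simp add: Finite_Cartesian_Product.vec_eq_iff)
  then obtain x where "\<And>i. v i $ x i \<noteq> 0" by metis
  then have "pure_tensor v $ x \<noteq> 0" by (simp add: pure_tensor_def)
  then show ?thesis by (metis zero_index)
qed

lemma proj_point_scale:
  assumes "c \<noteq> 0"
  shows "proj_point (c *s v) = proj_point v"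
proof -
  have "c *s v \<in> vec.span {v}" by (simp add: vec.span_base vec.span_scale)
  moreover have "inverse c *s (c *s v) \<in> vec.span {c *s v}"
    by (intro vec.span_scale vec.span_base) simp
  then have "v \<in> vec.span {c *s v}" using assms by simp
  ultimately show ?thesis
    unfolding proj_point_def by (intro vec.span_eq[THEN iffD2]) simp
qed

text \<open>A kernel is closed under scaling, so one representative decides for the whole line. This
  turns the domain of \<open>P_hat\<close> into a condition on vectors.\<close>

lemma proj_point_in_kernel_iff:
  assumes "Vector_Spaces.linear (*s) (*s) f" and "v \<noteq> 0"
  shows "proj_point v \<in> proj_space {t. f t = 0} \<longleftrightarrow> f v = 0"
proof
  interpret f: Vector_Spaces.linear "(*s)" "(*s)" f by fact
  assume "proj_point v \<in> proj_space {t. f t = 0}"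
  then obtain u where "f u = 0" "proj_point v = proj_point u"
    by (auto simp: proj_space_def)
  moreover have "v \<in> proj_point v" by (simp add: proj_point_def vec.span_base)
  ultimately show "f v = 0"
    by (auto simp: proj_point_def vec.span_singleton f.scale)
next
  assume "f v = 0"
  then show "proj_point v \<in> proj_space {t. f t = 0}"
    using assms(2) by (auto simp: proj_space_def)
qed

lemma perm_tensor_nth:
  assumes "bij w"
  shows "perm_tensor w t $ z = t $ (z \<circ> w)"
proof -
  \<comment> \<open>\<open>perm_index\<close> composes with the inverse of \<open>w\<close>, so
    solving for \<open>x\<close> brings back \<open>w\<close> itself and leaves a single
    summand.\<close>
  have eq: "z = perm_index w x \<longleftrightarrow> x = z \<circ> w" for x
    using assms by (auto simp: perm_index_def fun_eq_iff bij_is_inj bij_is_surj surj_f_inv_f)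
  have "perm_tensor w t $ z = (\<Sum>x\<in>UNIV. if x = z \<circ> w then t $ x else 0)"
    unfolding perm_tensor_def
    by (simp add: basis_tensor_eq_axis axis_def eq if_distrib cong: if_cong)
  then show ?thesis by simp
qed

lemma sum_basis_tensor_nth: "(\<Sum>z\<in>UNIV. c z *s basis_tensor z) $ y = c y"
proof -
  have "(\<Sum>z\<in>UNIV. c z *s basis_tensor z) $ y = (\<Sum>z\<in>UNIV. if z = y then c z else 0)"
    by (simp add: basis_tensor_eq_axis axis_def if_distrib cong: if_cong)
  then show ?thesis by simp
qed

lemma subgroup_Sym_bij: "subgroup G Sym \<Longrightarrow> g \<in> G \<Longrightarrow> bij g"
  using subgroup.subset[of G Sym] by (auto simp: BijGroup_def Bij_def)

lemma subgroup_Sym_inv: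
  assumes "subgroup G Sym" and "g \<in> G"
  shows "inv_into UNIV g \<in> G"
proof -
  have "g \<in> Bij UNIV" using subgroup_Sym_bij[OF assms] by (simp add: Bij_def)
  then show ?thesis
    using subgroup.m_inv_closed[OF assms] by (simp add: inv_BijGroup restrict_def)
qed

lemma algebra_op_P_char_pure_tensor:
  fixes A :: "complex ^ 'k::finite ^ 'n::finite"
  assumes G: "subgroup G Sym"
  shows "algebra_op (P_char G chi) (pure_tensor (\<lambda>j. column j A)) =
    (chi id / of_nat (card G)) *s (\<Sum>z\<in>UNIV. chi_entry G chi z id A *s basis_tensor z)"
    (is "?L = ?c *s ?R")
proof (subst Finite_Cartesian_Product.vec_eq_iff, intro allI)
  fix z :: "'k \<Rightarrow> 'n"
  let ?v = "\<lambda>j. column j A"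
  note bijG = subgroup_Sym_bij[OF G]
  have sub: "G \<subseteq> carrier Sym" using subgroup.subset[OF G] .
  have "?L $ z = (\<Sum>w\<in>carrier Sym. P_char G chi w * perm_tensor w (pure_tensor ?v) $ z)"
    by (simp add: algebra_op_def)
  also have "\<dots> = (\<Sum>w\<in>G. P_char G chi w * perm_tensor w (pure_tensor ?v) $ z)"
    by (rule sum.mono_neutral_right) (use sub in \<open>auto simp: P_char_def\<close>)
  also have "\<dots> = (\<Sum>w\<in>G. ?c * (chi (inv_into UNIV w) * (\<Prod>i\<in>UNIV. A $ z (w i) $ i)))"
    by (intro sum.cong refl)
      (simp add: P_char_def perm_tensor_nth bijG pure_tensor_def column_def)
  \<comment> \<open>The substitution of g for the inverse of w moves the inversion from the argument
    of \<open>chi\<close>, where \<open>P_char\<close> has it, to the index, where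
    \<open>perm_index\<close> has it.\<close>
  also have "\<dots> = (\<Sum>g\<in>G. ?c * (chi g * (\<Prod>i\<in>UNIV. A $ z (inv_into UNIV g i) $ i)))"
    by (rule sum.reindex_bij_witness[where i = "inv_into UNIV" and j = "inv_into UNIV"])
      (auto simp: subgroup_Sym_inv[OF G] inv_inv_eq bijG)
  also have "\<dots> = (?c *s ?R) $ z"
    unfolding vector_smult_component sum_basis_tensor_nth
    by (simp add: chi_entry_def tensor_power_entry_def perm_index_def sum_distrib_left)
  finally show "?L $ z = (?c *s ?R) $ z" .
qed

theorem theorem3p16:
  fixes G :: "('k::finite \<Rightarrow> 'k) set"
    and chi :: "('k \<Rightarrow> 'k) \<Rightarrow> complex"
  assumes "subgroup G Sym"
    and "simple_character (Sym\<lparr>carrier := G\<rparr>) chi"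
  shows "P_hat G chi ` (P_hat_domain G chi :: (complex ^ ('k \<Rightarrow> 'n::finite)) set set) =
    {proj_point (\<Sum>z\<in>UNIV. chi_entry G chi z id A *s basis_tensor z) | A :: complex ^ 'k ^ 'n.
      (\<forall>j. column j A \<noteq> 0) \<and>
      (\<Sum>z\<in>UNIV. chi_entry G chi z id A *s basis_tensor z) \<noteq> 0}"
proof -
  let ?f = "algebra_op (P_char G chi) :: complex ^ ('k \<Rightarrow> 'n) \<Rightarrow> _"
  let ?t = "\<lambda>A :: complex ^ 'k ^ 'n. pure_tensor (\<lambda>j. column j A)"
  let ?R = "\<lambda>A :: complex ^ 'k ^ 'n. \<Sum>z\<in>UNIV. chi_entry G chi z id A *s basis_tensor z"
  define c where "c = chi id / of_nat (card G)"
  have one: "\<one>\<^bsub>Sym\<^esub> = (id :: 'k \<Rightarrow> 'k)"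
    by (simp add: BijGroup_def restrict_def id_def)
  have "chi id \<noteq> 0"
    using simple_character_one_nonzero
      [OF subgroup.subgroup_is_group[OF assms(1) group_BijGroup] assms(2)]
    by (simp add: one)
  \<comment> \<open>This makes \<open>card G\<close> positive; otherwise division by zero would give
    \<open>c = 0\<close>.\<close>
  moreover have "id \<in> G" using subgroup.one_closed[OF assms(1)] by (simp add: one)
  ultimately have c: "c \<noteq> 0" by (auto simp: c_def card_eq_0_iff)
  have f: "?f (?t A) = c *s ?R A" for A
    unfolding c_def by (rule algebra_op_P_char_pure_tensor[OF assms(1)])
  \<comment> \<open>The tensor factors become the columns of a matrix, so matrices without zero
    columns parametrize \<open>Seg\<close>.\<close>
  have columns: "\<exists>A :: complex ^ 'k ^ 'n. v = (\<lambda>j. column j A)" for v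
    by (rule exI[of _ "\<chi> i j. v j $ i"]) (simp add: column_def fun_eq_iff Finite_Cartesian_Product.vec_eq_iff)
  have Seg: "Seg = {proj_point (?t A) | A. \<forall>j. column j A \<noteq> 0}"
  proof (intro equalityI subsetI)
    fix L :: "(complex ^ ('k \<Rightarrow> 'n)) set"
    assume "L \<in> Seg"
    then obtain v where v: "L = proj_point (pure_tensor v)" "\<forall>i. v i \<noteq> 0"
      by (auto simp: Seg_def)
    obtain A where "v = (\<lambda>j. column j A)" using columns[of v] by blast
    with v show "L \<in> {proj_point (?t A) | A. \<forall>j. column j A \<noteq> 0}" by blast
  qed (auto simp: Seg_def)
  have kernel: "proj_point (?t A) \<in> proj_space {t. ?f t = 0} \<longleftrightarrow> ?f (?t A) = 0"
    if "\<forall>j. column j A \<noteq> 0" for A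
    using that by (intro proj_point_in_kernel_iff linear_algebra_op pure_tensor_nonzero) simp
  \<comment> \<open>Different matrices can give the same point of \<open>Seg\<close>. By
    \<open>kernel\<close> they agree on whether \<open>?f\<close> vanishes, so removing points
    amounts to removing matrices.\<close>
  have "P_hat_domain G chi =
      (\<lambda>A. proj_point (?t A)) ` {A. (\<forall>j. column j A \<noteq> 0) \<and> ?f (?t A) \<noteq> 0}"
    unfolding P_hat_domain_def Seg using kernel by blast
  then have "P_hat G chi ` P_hat_domain G chi =
      (\<lambda>A. proj_point (?f (?t A))) ` {A. (\<forall>j. column j A \<noteq> 0) \<and> ?f (?t A) \<noteq> 0}"
    by (simp only: image_image P_hat_pure_tensor)
  \<comment> \<open>The nonzero factor \<open>c\<close> affects neither the line nor the
    nonvanishing condition.\<close>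
  also have "\<dots> = (\<lambda>A. proj_point (?R A)) ` {A. (\<forall>j. column j A \<noteq> 0) \<and> ?R A \<noteq> 0}"
    by (simp only: f proj_point_scale[OF c] vec.scale_eq_0_iff c simp_thms)
  finally show ?thesis
    by (simp only: image_Collect)
qed

end
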